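(* Let $a=(a_1,a_2)$, $b=(b_1,b_2)$, $c=(c_1,c_2)$ be three points in $\mathbb{R}^2$. Then $a,b,c$ determine a transversal tropical triangle if and only if, perhaps after relabeling the three points, the following inequalities hold: $$a_1<b_1<c_1,\qquad a_2<c_2<b_2,\qquad b_1-b_2<a_1-a_2<c_1-c_2.$$ In particular, the set of $(a_1,a_2,b_1,b_2,c_1,c_2)\in\mathbb{R}^6$ satisfying these inequalities is an open unbounded polyhedron in $\mathbb{R}^6$, invariant under adding $\lambda(1,1,1,1,1,1)$ for every $\lambda\in\mathbb{R}$, so that it may be viewed projectively in $\mathbb{T}\mathbb{P}^5$.
   Context: The tropical semifield is $\mathbb{T}=\mathbb{R}\cup\{-\infty\}$ with $x\oplus y=\max\{x,y\}$, $x\odot y=x+y$. Identify $\mathbb{R}^2$ with the interior points of the tropical projective plane $\mathbb{T}\mathbb{P}^2$ (which is $\mathbb{T}^3\setminus\{(-\infty,-\infty,-\infty)\}$ modulo adding real multiples of $(1,1,1)$, classes written $[x_1,x_2,x_3]$) via $(x,y)\mapsto[x,y,0]$. A tropical line is a set $\{[x_1,x_2,x_3]:\max\{u_1+x_1,u_2+x_2,u_3+x_3\}\text{ attained at least twice}\}$ with $u_1,u_2,u_3\in\mathbb{R}$ (restricted to $\mathbb{R}^2$ in the affine picture). Two points are transversal if exactly one tropical line passes through both; for transversal points $p,q$ this line is denoted $pq$. Two tropical lines are transversal if they intersect in exactly one point. Three points $a,b,c$ determine a transversal tropical triangle if they are distinct, tropically non-collinear (no tropical line contains all three), pairwise transversal,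 and the three tropical lines $ab,bc,ca$ are pairwise transversal. *)

theory Defs
  imports "HOL-Analysis.Analysis"
begin

(* The tropical semifield is the set of ereals other than \<infinity>. On it, tropical addition is
   max and tropical multiplication is +, and +, \<le> of ereal have the intended meaning. *)

definition trop_coords :: "(ereal ^ 'n) set" where
  "trop_coords = {x. (\<forall>i. x $ i \<noteq> \<infinity>) \<and> (\<exists>i. x $ i \<noteq> -\<infinity>)}"

definition trop_class :: "ereal ^ 'n \<Rightarrow> (ereal ^ 'n) set" where
  "trop_class x = {y. \<exists>l::real. \<forall>i. y $ i = x $ i + ereal l}"

(* With CARD('n) = n + 1 this is the n-dimensional tropical projective space. *)
definition trop_proj :: "(ereal ^ 'n) set set" where
  "trop_proj = trop_class ` trop_coords"

definition interior_point :: "real ^ 'n \<Rightarrow> (ereal ^ 'n) set" where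
  "interior_point x = trop_class (\<chi> i. ereal (x $ i))"

definition affine_point :: "real ^ 2 \<Rightarrow> (ereal ^ 3) set" where
  "affine_point p = interior_point (vector [p $ 1, p $ 2, 0])"

definition max_attained_twice :: "('n \<Rightarrow> ereal) \<Rightarrow> bool" where
  "max_attained_twice f \<longleftrightarrow> (\<exists>i j. i \<noteq> j \<and> f i = f j \<and> (\<forall>k. f k \<le> f i))"

definition trop_line :: "real ^ 3 \<Rightarrow> (ereal ^ 3) set set" where
  "trop_line u =
     {trop_class x | x. x \<in> trop_coords \<and> max_attained_twice (\<lambda>i. ereal (u $ i) + x $ i)}"

definition trop_lines :: "(ereal ^ 3) set set set" where
  "trop_lines = range trop_line"

definition transversal_points :: "(ereal ^ 3) set \<Rightarrow> (ereal ^ 3) set \<Rightarrow> bool" where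
  "transversal_points p q \<longleftrightarrow> (\<exists>!L. L \<in> trop_lines \<and> p \<in> L \<and> q \<in> L)"

(* Meaningful for transversal points only. *)
definition line_through :: "(ereal ^ 3) set \<Rightarrow> (ereal ^ 3) set \<Rightarrow> (ereal ^ 3) set set" where
  "line_through p q = (THE L. L \<in> trop_lines \<and> p \<in> L \<and> q \<in> L)"

definition transversal_lines :: "(ereal ^ 3) set set \<Rightarrow> (ereal ^ 3) set set \<Rightarrow> bool" where
  "transversal_lines L M \<longleftrightarrow> (\<exists>!p. p \<in> L \<inter> M)"

definition trop_collinear :: "(ereal ^ 3) set \<Rightarrow> (ereal ^ 3) set \<Rightarrow> (ereal ^ 3) set \<Rightarrow> bool" where
  "trop_collinear a b c \<longleftrightarrow> (\<exists>L \<in> trop_lines. a \<in> L \<and> b \<in> L \<and> c \<in> L)"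

definition transversal_triangle ::
    "(ereal ^ 3) set \<Rightarrow> (ereal ^ 3) set \<Rightarrow> (ereal ^ 3) set \<Rightarrow> bool" where
  "transversal_triangle a b c \<longleftrightarrow>
     a \<noteq> b \<and> b \<noteq> c \<and> c \<noteq> a \<and>
     \<not> trop_collinear a b c \<and>
     transversal_points a b \<and> transversal_points b c \<and> transversal_points c a \<and>
     transversal_lines (line_through a b) (line_through b c) \<and>
     transversal_lines (line_through b c) (line_through c a) \<and>
     transversal_lines (line_through c a) (line_through a b)"

definition triangle_ineqs :: "real ^ 2 \<Rightarrow> real ^ 2 \<Rightarrow> real ^ 2 \<Rightarrow> bool" where
  "triangle_ineqs a b c \<longleftrightarrow>
     a $ 1 < b $ 1 \<and> b $ 1 < c $ 1 \<and>
     a $ 2 < c $ 2 \<and> c $ 2 < b $ 2 \<and>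
     b $ 1 - b $ 2 < a $ 1 - a $ 2 \<and> a $ 1 - a $ 2 < c $ 1 - c $ 2"

definition triangle_region :: "(real ^ 6) set" where
  "triangle_region =
     {vector [a $ 1, a $ 2, b $ 1, b $ 2, c $ 1, c $ 2] | a b c. triangle_ineqs a b c}"

(* The library's polyhedron is an intersection of closed half-spaces. *)
definition open_polyhedron :: "'a::euclidean_space set \<Rightarrow> bool" where
  "open_polyhedron S \<longleftrightarrow>
     (\<exists>F. finite F \<and> S = \<Inter> F \<and> (\<forall>h \<in> F. \<exists>a b. a \<noteq> 0 \<and> h = {x. a \<bullet> x < b}))"

end

theory Submission
  imports Defs
begin

text \<open>
  Incidence of a real point \<open>x\<close> with the line of coefficients \<open>u\<close> depends only on \<open>u + x\<close>, so it is
  symmetric: points and lines are dual. Two lines \<open>u\<close>, \<open>v\<close> meet exactly once, and dually two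
  points span exactly one line, iff the coordinates of \<open>u - v\<close> are pairwise distinct; the meet or
  span is then the tropical cross product, while otherwise there is a whole ray of solutions.
  A generic pair of lines has no common point on the boundary of the projective plane. Hence a
  transversal triangle is described by order conditions on differences of points and of cross
  products, and these reduce, up to relabelling, to the stated linear inequalities. Collinearity
  needs no separate treatment: on a common line the three sides coincide, and a line is not
  transversal to itself.
\<close>

section \<open>Incidence in real coordinates and the tropical cross product\<close>

definition incident :: "real ^ 3 \<Rightarrow> real ^ 3 \<Rightarrow> bool" where
  "incident u x \<longleftrightarrow> max_attained_twice (\<lambda>i. ereal (u $ i + x $ i))"

definition generic :: "real ^ 'n \<Rightarrow> bool" where
  "generic d \<longleftrightarrow> inj (($) d)"

text \<open>The 2x2 minors of the matrix with rows \<open>u\<close> and \<open>v\<close>, with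
  maximum in place of the signed sum: Cramer's rule in tropical form.\<close>

definition trop_cross :: "real ^ 3 \<Rightarrow> real ^ 3 \<Rightarrow> real ^ 3" where
  "trop_cross u v = vector
     [max (u $ 2 + v $ 3) (u $ 3 + v $ 2),
      max (u $ 3 + v $ 1) (u $ 1 + v $ 3),
      max (u $ 1 + v $ 2) (u $ 2 + v $ 1)]"

lemma trop_cross_nth [simp]:
  "trop_cross u v $ 1 = max (u $ 2 + v $ 3) (u $ 3 + v $ 2)"
  "trop_cross u v $ 2 = max (u $ 3 + v $ 1) (u $ 1 + v $ 3)"
  "trop_cross u v $ 3 = max (u $ 1 + v $ 2) (u $ 2 + v $ 1)"
  by (simp_all add: trop_cross_def)

lemma exists_3: "(\<exists>i::3. P i) \<longleftrightarrow> P 1 \<or> P 2 \<or> P 3"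
  using forall_3[of "\<lambda>i. \<not> P i"] by auto

lemma max_attained_twice_3:
  fixes f :: "3 \<Rightarrow> ereal"
  shows "max_attained_twice f \<longleftrightarrow>
    f 1 = f 2 \<and> f 3 \<le> f 1 \<or> f 1 = f 3 \<and> f 2 \<le> f 1 \<or> f 2 = f 3 \<and> f 1 \<le> f 2"
  by (auto simp: max_attained_twice_def exists_3 forall_3)

lemma incident_3:
  "incident u x \<longleftrightarrow>
     u $ 1 + x $ 1 = u $ 2 + x $ 2 \<and> u $ 3 + x $ 3 \<le> u $ 1 + x $ 1 \<or>
     u $ 1 + x $ 1 = u $ 3 + x $ 3 \<and> u $ 2 + x $ 2 \<le> u $ 1 + x $ 1 \<or>
     u $ 2 + x $ 2 = u $ 3 + x $ 3 \<and> u $ 1 + x $ 1 \<le> u $ 2 + x $ 2"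
  by (simp add: incident_def max_attained_twice_3)

lemma generic_3: "generic (d :: real ^ 3) \<longleftrightarrow> d $ 1 \<noteq> d $ 2 \<and> d $ 2 \<noteq> d $ 3 \<and> d $ 1 \<noteq> d $ 3"
  by (auto simp: generic_def inj_def forall_3)

lemma incident_commute: "incident u x \<longleftrightarrow> incident x u"
  by (simp add: incident_def add.commute)

lemma incident_add_scaleR_one [simp]: "incident u (x + l *\<^sub>R 1) \<longleftrightarrow> incident u x"
  by (auto simp: incident_3)

lemma incident_trop_cross:
  assumes "generic (u - v)"
  shows "incident u (trop_cross u v)" "incident v (trop_cross u v)"
  using assms unfolding incident_3 generic_3 by (simp_all add: max_def)

text \<open>If both maxima were tied at the same pair of indices, \<open>u - v\<close> would agree
  there, against genericity. Two different pairs of ties fix all differences of coordinates of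
  \<open>x\<close>; the inequalities select the maxima in \<open>trop_cross\<close>.\<close>

lemma incident_trop_cross_unique:
  assumes "generic (u - v)" "incident u x" "incident v x"
  shows "\<exists>l. x = trop_cross u v + l *\<^sub>R 1"
proof (intro exI)
  have "x $ 1 - x $ 3 = trop_cross u v $ 1 - trop_cross u v $ 3"
      "x $ 2 - x $ 3 = trop_cross u v $ 2 - trop_cross u v $ 3"
    using assms unfolding incident_3 generic_3 vector_minus_component trop_cross_nth
    by (smt (verit))+
  then show "x = trop_cross u v + (x $ 3 - trop_cross u v $ 3) *\<^sub>R 1"
    by (simp add: vec_eq_iff forall_3)
qed

text \<open>
  The condition \<open>\<not> incident (- x) y\<close> separates \<open>x\<close> and \<open>y\<close> both as points (adding a
  multiple of \<open>1\<close> does not take \<open>x\<close> to \<open>y\<close>) and as lines (the apex \<open>- x\<close>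
  of the line \<open>x\<close> is not on the line \<open>y\<close>).
\<close>

lemma not_generic_incident:
  assumes "\<not> generic (u - v)"
  obtains x y where "incident u x" "incident v x" "incident u y" "incident v y" "\<not> incident (- x) y"
proof -
  from assms obtain i j :: 3
    where ij: "(i, j) \<in> {(1, 2), (2, 3), (1, 3)}" "u $ i - v $ i = u $ j - v $ j"
    by (force simp: generic_3)
  \<comment> \<open>The shift by \<open>u $ i - v $ i\<close> makes \<open>v\<close> agree with
    \<open>u\<close> at \<open>i\<close> and \<open>j\<close>; \<open>M\<close> bounds all
    coordinates of both.\<close>
  define M where "M = (MAX k. max (u $ k) (v $ k + (u $ i - v $ i)))"
  have "max (u $ k) (v $ k + (u $ i - v $ i)) \<le> M" for k
    unfolding M_def by (rule Max_ge) auto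
  then have M: "u $ k \<le> M" "v $ k + (u $ i - v $ i) \<le> M" for k
    by (simp_all add: max.bounded_iff)
  \<comment> \<open>Lowering the remaining coordinate further leaves the maximum attained at \<open>i\<close> and \<open>j\<close>,
    so the points \<open>w M\<close> form a whole ray.\<close>
  define w where "w M = (\<chi> k. if k = i \<or> k = j then - u $ k else - M)" for M :: real
  show ?thesis
  proof
    \<comment> \<open>\<open>w M - w (M + 1)\<close> is 0 at \<open>i\<close> and \<open>j\<close>
      and 1 at the third index, so its maximum is attained only once.\<close>
    show "incident u (w M)" "incident v (w M)" "incident u (w (M + 1))" "incident v (w (M + 1))"
       "\<not> incident (- w (M + 1)) (w M)"
      using ij M[of 1] M[of 2] M[of 3]
      by (auto simp: incident_3 w_def)
  qed
qed

section \<open>Projective classes and their representatives\<close>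

lemma mem_trop_class: "x \<in> trop_class x"
  by (auto simp: trop_class_def intro: exI[of _ 0])

lemma trop_class_eqI:
  assumes "\<And>i. y $ i = x $ i + ereal l"
  shows "trop_class y = trop_class x"
proof -
  have "(\<forall>i. z $ i = y $ i + ereal k) \<longleftrightarrow> (\<forall>i. z $ i = x $ i + ereal (l + k))" for z k
    using assms by (simp add: add.assoc)
  then have "(\<exists>k. \<forall>i. z $ i = y $ i + ereal k) \<longleftrightarrow> (\<exists>k. \<forall>i. z $ i = x $ i + ereal k)" for z
    by (metis add_diff_cancel_left' diff_add_cancel add.commute)
  then show ?thesis
    by (simp add: trop_class_def)
qed

lemma trop_class_eqD:
  assumes "trop_class y = trop_class x"
  obtains l where "\<And>i. y $ i = x $ i + ereal l"
proof -
  have "y \<in> trop_class x"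
    using assms mem_trop_class by blast
  with that show ?thesis
    by (auto simp: trop_class_def)
qed

lemma interior_point_eq_iff: "interior_point y = interior_point x \<longleftrightarrow> (\<exists>l. y = x + l *\<^sub>R 1)"
proof
  assume "interior_point y = interior_point x"
  then obtain l where "\<And>i. ereal (y $ i) = ereal (x $ i) + ereal l"
    unfolding interior_point_def by (elim trop_class_eqD) simp
  then show "\<exists>l. y = x + l *\<^sub>R 1"
    by (intro exI[of _ l]) (simp add: vec_eq_iff)
next
  assume "\<exists>l. y = x + l *\<^sub>R 1"
  then obtain l where "y = x + l *\<^sub>R 1"
    by blast
  then show "interior_point y = interior_point x"
    unfolding interior_point_def by (intro trop_class_eqI[of _ _ l]) simp
qed

section \<open>Points on tropical lines\<close>

lemma max_attained_twice_add:
  "max_attained_twice (\<lambda>i. f i + ereal l) \<longleftrightarrow> max_attained_twice f"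
  by (simp add: max_attained_twice_def ereal_add_le_add_iff2 ereal_add_cancel_right)

text \<open>The definition of a line asks for some representative with a double maximum; a real
  shift preserves this, so any representative decides membership.\<close>

lemma trop_class_mem_trop_line:
  assumes "x \<in> trop_coords"
  shows "trop_class x \<in> trop_line u \<longleftrightarrow> max_attained_twice (\<lambda>i. ereal (u $ i) + x $ i)"
proof
  assume "trop_class x \<in> trop_line u"
  then obtain y where y: "trop_class x = trop_class y" "max_attained_twice (\<lambda>i. ereal (u $ i) + y $ i)"
    by (auto simp: trop_line_def)
  then obtain l where "\<And>i. x $ i = y $ i + ereal l"
    by (elim trop_class_eqD) blast
  then show "max_attained_twice (\<lambda>i. ereal (u $ i) + x $ i)"
    using y(2) max_attained_twice_add[of "\<lambda>i. ereal (u $ i) + y $ i" l] by (simp add: add.assoc)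
qed (use assms in \<open>auto simp: trop_line_def\<close>)

lemma interior_point_mem_trop_line: "interior_point x \<in> trop_line u \<longleftrightarrow> incident u x"
  by (simp add: interior_point_def trop_class_mem_trop_line trop_coords_def incident_def)

lemma trop_line_add_scaleR_one [simp]: "trop_line (u + l *\<^sub>R 1) = trop_line u"
proof -
  have "max_attained_twice (\<lambda>i. ereal ((u + l *\<^sub>R 1) $ i) + x $ i) \<longleftrightarrow>
      max_attained_twice (\<lambda>i. ereal (u $ i) + x $ i)" for x
    using max_attained_twice_add[of "\<lambda>i. ereal (u $ i) + x $ i" l]
    by (simp add: add.assoc add.commute[of "x $ _" "ereal l"] flip: plus_ereal.simps(1))
  then show ?thesis
    by (simp add: trop_line_def)
qed

text \<open>With two coordinates -\<infinity> the maximum is attained only once. With exactly one,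
  both lines have their tie at the other two indices, so \<open>u - v\<close> agrees there.\<close>

lemma generic_trop_lines_meet_in_interior:
  assumes "generic (u - v)" "P \<in> trop_line u" "P \<in> trop_line v"
  obtains x where "P = interior_point x"
proof -
  obtain y where y: "y \<in> trop_coords" "P = trop_class y"
      "max_attained_twice (\<lambda>i. ereal (u $ i) + y $ i)"
    using assms(2) by (auto simp: trop_line_def)
  have v: "max_attained_twice (\<lambda>i. ereal (v $ i) + y $ i)"
    using assms(3) y by (simp add: trop_class_mem_trop_line)
  have "y $ 1 \<noteq> -\<infinity> \<and> y $ 2 \<noteq> -\<infinity> \<and> y $ 3 \<noteq> -\<infinity>"
    using y(1,3) v assms(1)
    unfolding trop_coords_def max_attained_twice_3 generic_3 forall_3 exists_3
    by (cases "y $ 1"; cases "y $ 2"; cases "y $ 3") auto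
  then have "\<bar>y $ i\<bar> \<noteq> \<infinity>" for i
    using y(1) exhaust_3[of i] by (auto simp: trop_coords_def)
  then have "y = (\<chi> i. ereal ((\<chi> i. real_of_ereal (y $ i)) $ i))"
    by (simp add: vec_eq_iff ereal_real)
  then show ?thesis
    using that y(2) unfolding interior_point_def by metis
qed

section \<open>Transversality as genericity\<close>

lemma transversal_lines_iff: "transversal_lines (trop_line u) (trop_line v) \<longleftrightarrow> generic (u - v)"
proof
  assume L: "transversal_lines (trop_line u) (trop_line v)"
  show "generic (u - v)"
  proof (rule ccontr)
    assume "\<not> generic (u - v)"
    then obtain x y where xy: "incident u x" "incident v x" "incident u y" "incident v y"
        "\<not> incident (- x) y"
      by (rule not_generic_incident)
    then have "interior_point x \<in> trop_line u \<inter> trop_line v"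
        "interior_point y \<in> trop_line u \<inter> trop_line v"
      by (simp_all add: interior_point_mem_trop_line)
    with L have "interior_point y = interior_point x"
      unfolding transversal_lines_def by blast
    then obtain l where "y = x + l *\<^sub>R 1"
      by (auto simp: interior_point_eq_iff)
    \<comment> \<open>All coordinates of \<open>- x + y\<close> equal \<open>l\<close>.\<close>
    then have "incident (- x) y"
      by (simp add: incident_3)
    with xy show False
      by simp
  qed
next
  assume g: "generic (u - v)"
  have "P = interior_point (trop_cross u v)" if P: "P \<in> trop_line u \<inter> trop_line v" for P
  proof -
    obtain x where x: "P = interior_point x"
      using generic_trop_lines_meet_in_interior g P by blast
    with P have "\<exists>l. x = trop_cross u v + l *\<^sub>R 1"
      by (intro incident_trop_cross_unique[OF g]) (simp_all add: interior_point_mem_trop_line)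
    with x show ?thesis
      by (simp add: interior_point_eq_iff)
  qed
  moreover have "interior_point (trop_cross u v) \<in> trop_line u \<inter> trop_line v"
    using g by (simp add: interior_point_mem_trop_line incident_trop_cross)
  ultimately show "transversal_lines (trop_line u) (trop_line v)"
    unfolding transversal_lines_def by blast
qed

text \<open>Dual to the meet of two lines: the coefficients of a line through both points form a
  common point of the lines with coefficients \<open>p\<close> and \<open>q\<close>.\<close>

lemma trop_line_through_unique:
  assumes "generic (p - q)"
  shows "L \<in> trop_lines \<and> interior_point p \<in> L \<and> interior_point q \<in> L \<longleftrightarrow>
    L = trop_line (trop_cross p q)"
proof
  assume "L \<in> trop_lines \<and> interior_point p \<in> L \<and> interior_point q \<in> L"
  then obtain u where u: "L = trop_line u" "incident p u" "incident q u"
    by (auto simp: trop_lines_def interior_point_mem_trop_line incident_commute)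
  with incident_trop_cross_unique[OF assms] obtain l where "u = trop_cross p q + l *\<^sub>R 1"
    by blast
  with u show "L = trop_line (trop_cross p q)"
    by simp
qed (use assms in \<open>auto simp: trop_lines_def interior_point_mem_trop_line
       incident_commute[of "trop_cross p q"] incident_trop_cross\<close>)

lemma transversal_points_iff:
  "transversal_points (interior_point p) (interior_point q) \<longleftrightarrow> generic (p - q)"
proof
  assume L: "transversal_points (interior_point p) (interior_point q)"
  show "generic (p - q)"
  proof (rule ccontr)
    assume "\<not> generic (p - q)"
    then obtain u v where uv: "incident p u" "incident q u" "incident p v" "incident q v"
        "\<not> incident (- u) v"
      by (rule not_generic_incident)
    then have "trop_line u = trop_line v"
      using L unfolding transversal_points_def trop_lines_def
      by (metis incident_commute interior_point_mem_trop_line rangeI)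
    moreover have "incident u (- u)"
      by (simp add: incident_3)
    ultimately have "incident v (- u)"
      by (metis interior_point_mem_trop_line)
    with uv show False
      by (simp add: incident_commute)
  qed
qed (simp add: transversal_points_def trop_line_through_unique)

lemma line_through_interior_points:
  assumes "generic (p - q)"
  shows "line_through (interior_point p) (interior_point q) = trop_line (trop_cross p q)"
  unfolding line_through_def using trop_line_through_unique[OF assms] by (intro the_equality) blast+

lemma not_generic_zero [simp]: "\<not> generic (0 :: real ^ 3)"
  by (simp add: generic_3)

section \<open>Transversal triangles and relabelling\<close>

lemma transversal_triangle_interior_iff:
  "transversal_triangle (interior_point p) (interior_point q) (interior_point r) \<longleftrightarrow>
     generic (p - q) \<and> generic (q - r) \<and> generic (r - p) \<and>
     generic (trop_cross p q - trop_cross q r) \<and> generic (trop_cross q r - trop_cross r p) \<and>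
     generic (trop_cross r p - trop_cross p q)" (is "_ \<longleftrightarrow> ?R")
proof
  assume R: ?R
  have ne: "interior_point x \<noteq> interior_point y" if "generic (x - y)" for x y :: "real ^ 3"
    using that by (auto simp: interior_point_eq_iff generic_3)
  have "\<not> trop_collinear (interior_point p) (interior_point q) (interior_point r)"
  proof
    assume "trop_collinear (interior_point p) (interior_point q) (interior_point r)"
    then have "trop_line (trop_cross p q) = trop_line (trop_cross q r)"
      using R trop_line_through_unique unfolding trop_collinear_def by metis
    with R have "transversal_lines (trop_line (trop_cross p q)) (trop_line (trop_cross p q))"
      by (metis transversal_lines_iff)
    then show False
      by (simp add: transversal_lines_iff)
  qed
  with R ne show "transversal_triangle (interior_point p) (interior_point q) (interior_point r)"
    by (simp add: transversal_triangle_def transversal_points_iff line_through_interior_points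
        transversal_lines_iff)
qed (auto simp: transversal_triangle_def transversal_points_iff line_through_interior_points
      transversal_lines_iff)

text \<open>Together with the rotation below, this swap generates all relabellings of the
  vertices.\<close>

lemma transversal_triangle_swap: "transversal_triangle p q r \<longleftrightarrow> transversal_triangle q p r"
proof -
  have "transversal_points x y \<longleftrightarrow> transversal_points y x" "line_through x y = line_through y x"
      "trop_collinear p q r \<longleftrightarrow> trop_collinear q p r" for x y
    unfolding transversal_points_def line_through_def trop_collinear_def
    by (simp_all add: conj_ac)
  moreover have "transversal_lines K M \<longleftrightarrow> transversal_lines M K" for K M
    by (simp add: transversal_lines_def Int_commute)
  ultimately show ?thesis
    unfolding transversal_triangle_def by (smt (verit))
qed

lemma transversal_triangle_rotate: "transversal_triangle p q r \<longleftrightarrow> transversal_triangle q r p"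
  by (auto simp: transversal_triangle_def trop_collinear_def)

text \<open>The inequalities resolve every maximum: the sides ab, bc, ca have coefficients (b2, b1,
  a1 + b2), (b2, c1, b2 + c1), (c2, c1, c1 + a2).\<close>

lemma triangle_ineqs_imp_transversal_triangle:
  assumes "triangle_ineqs a b c"
  shows "transversal_triangle (affine_point a) (affine_point b) (affine_point c)"
  using assms
  unfolding affine_point_def transversal_triangle_interior_iff generic_3 triangle_ineqs_def
  by (simp add: max_def)

text \<open>Pairwise genericity means that x1, x2 and x1 - x2 each order the three points strictly.
  These orders resolve every maximum, and genericity of the sides leaves only the six
  labellings.\<close>

lemma transversal_triangle_imp_triangle_ineqs:
  assumes "transversal_triangle (affine_point a) (affine_point b) (affine_point c)"
  shows "triangle_ineqs a b c \<or> triangle_ineqs a c b \<or> triangle_ineqs b a c \<or>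
    triangle_ineqs b c a \<or> triangle_ineqs c a b \<or> triangle_ineqs c b a"
  using assms
  unfolding affine_point_def transversal_triangle_interior_iff generic_3 triangle_ineqs_def
  by (simp only: vector_3 vector_minus_component trop_cross_nth) (smt (verit))

text \<open>Equality of multisets expresses relabelling, also when some of the points
  coincide.\<close>

lemma mset_3_eq_iff:
  "mset [p, q, r] = mset [a, b, c] \<longleftrightarrow>
     (p, q, r) \<in> {(a, b, c), (a, c, b), (b, a, c), (b, c, a), (c, a, b), (c, b, a)}"
  by (auto simp: add_eq_conv_ex)

lemma transversal_triangle_affine_iff:
  "transversal_triangle (affine_point a) (affine_point b) (affine_point c) \<longleftrightarrow>
     (\<exists>p q r. mset [p, q, r] = mset [a, b, c] \<and> triangle_ineqs p q r)"
proof
  assume "transversal_triangle (affine_point a) (affine_point b) (affine_point c)"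
  from transversal_triangle_imp_triangle_ineqs[OF this]
  show "\<exists>p q r. mset [p, q, r] = mset [a, b, c] \<and> triangle_ineqs p q r"
    unfolding mset_3_eq_iff by blast
next
  assume "\<exists>p q r. mset [p, q, r] = mset [a, b, c] \<and> triangle_ineqs p q r"
  then obtain p q r where
      pqr: "(p, q, r) \<in> {(a, b, c), (a, c, b), (b, a, c), (b, c, a), (c, a, b), (c, b, a)}"
      and "triangle_ineqs p q r"
    unfolding mset_3_eq_iff by blast
  define T where "T x y z = transversal_triangle (affine_point x) (affine_point y) (affine_point z)"
    for x y z
  have swap: "T x y z \<longleftrightarrow> T y x z" and rotate: "T x y z \<longleftrightarrow> T y z x" for x y z
    unfolding T_def by (rule transversal_triangle_swap, rule transversal_triangle_rotate)
  have "T p q r"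
    unfolding T_def by (rule triangle_ineqs_imp_transversal_triangle) fact
  with pqr have "T a b c \<or> T a c b \<or> T b a c \<or> T b c a \<or> T c a b \<or> T c b a"
    by auto
  \<comment> \<open>These five equivalences connect all six orders of the vertices.\<close>
  then have "T a b c"
    using rotate[of a b c] rotate[of b c a] swap[of a b c] rotate[of b a c] rotate[of a c b]
    by argo
  then show "transversal_triangle (affine_point a) (affine_point b) (affine_point c)"
    by (simp add: T_def)
qed

section \<open>The region of parameters in six dimensions\<close>

lemma exhaust_6:
  fixes i :: 6
  shows "i = 1 \<or> i = 2 \<or> i = 3 \<or> i = 4 \<or> i = 5 \<or> i = 6"
proof (induct i)
  case (of_int z)
  \<comment> \<open>Representatives run from 0 to 5, and 0 is the same element as 6 in this
    type.\<close>
  then have "z = 0 \<or> z = 1 \<or> z = 2 \<or> z = 3 \<or> z = 4 \<or> z = 5"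
    by simp arith
  then show ?case
    by auto
qed

lemma vector_6 [simp]:
  fixes x1 :: "'a :: zero"
  shows "(vector [x1, x2, x3, x4, x5, x6] :: 'a ^ 6) $ 1 = x1"
    "(vector [x1, x2, x3, x4, x5, x6] :: 'a ^ 6) $ 2 = x2"
    "(vector [x1, x2, x3, x4, x5, x6] :: 'a ^ 6) $ 3 = x3"
    "(vector [x1, x2, x3, x4, x5, x6] :: 'a ^ 6) $ 4 = x4"
    "(vector [x1, x2, x3, x4, x5, x6] :: 'a ^ 6) $ 5 = x5"
    "(vector [x1, x2, x3, x4, x5, x6] :: 'a ^ 6) $ 6 = x6"
  unfolding vector_def by simp_all

lemma mem_triangle_region:
  "x \<in> triangle_region \<longleftrightarrow>
     x $ 1 < x $ 3 \<and> x $ 3 < x $ 5 \<and> x $ 2 < x $ 6 \<and> x $ 6 < x $ 4 \<and>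
     x $ 3 - x $ 4 < x $ 1 - x $ 2 \<and> x $ 1 - x $ 2 < x $ 5 - x $ 6" (is "_ \<longleftrightarrow> ?R x")
proof
  assume R: "?R x"
  define a b c :: "real ^ 2"
    where abc: "a = vector [x $ 1, x $ 2]" "b = vector [x $ 3, x $ 4]" "c = vector [x $ 5, x $ 6]"
  have "x $ i = vector [a $ 1, a $ 2, b $ 1, b $ 2, c $ 1, c $ 2] $ i" for i
    using exhaust_6[of i] by (auto simp: abc)
  then have "x = vector [a $ 1, a $ 2, b $ 1, b $ 2, c $ 1, c $ 2]"
    by (simp add: vec_eq_iff)
  moreover have "triangle_ineqs a b c"
    using R by (simp add: triangle_ineqs_def abc)
  ultimately show "x \<in> triangle_region"
    unfolding triangle_region_def by blast
qed (auto simp: triangle_region_def triangle_ineqs_def)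

lemma add_scaleR_one_mem_triangle_region [simp]:
  "x + l *\<^sub>R 1 \<in> triangle_region \<longleftrightarrow> x \<in> triangle_region"
  by (simp add: mem_triangle_region)

lemma open_polyhedron_triangle_region: "open_polyhedron triangle_region"
proof -
  define e where "e i = axis i (1 :: real)" for i :: 6
  \<comment> \<open>One normal \<open>n\<close> per inequality, with both sides collected into
    \<open>n \<bullet> x < 0\<close>.\<close>
  define N where "N = {e 1 - e 3, e 3 - e 5, e 2 - e 6, e 6 - e 4,
    e 3 - e 4 - (e 1 - e 2), e 1 - e 2 - (e 5 - e 6)}"
  have e: "x \<bullet> e i = x $ i" "e i \<bullet> x = x $ i" for x i
    by (simp_all add: e_def inner_axis inner_commute[of _ x])
  have nth: "e i $ j = (if j = i then 1 else 0)" for i j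
    by (simp add: e_def axis_def)
  have "triangle_region = \<Inter> ((\<lambda>n. {x. n \<bullet> x < 0}) ` N)"
    by (auto simp: N_def mem_triangle_region inner_diff_left e)
  moreover have "n \<noteq> 0" if "n \<in> N" for n
  proof -
    \<comment> \<open>Each of the six normals involves coordinate 1, 3 or 6.\<close>
    have "n $ 1 \<noteq> 0 \<or> n $ 3 \<noteq> 0 \<or> n $ 6 \<noteq> 0"
      using that by (auto simp: N_def nth)
    then show ?thesis
      by auto
  qed
  moreover have "finite N"
    by (simp add: N_def)
  ultimately show ?thesis
    unfolding open_polyhedron_def
    by (intro exI[of _ "(\<lambda>n. {x. n \<bullet> x < 0}) ` N"]) blast
qed

lemma open_open_polyhedron:
  assumes "open_polyhedron S"
  shows "open S"
  using assms unfolding open_polyhedron_def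
  by (auto intro!: open_Inter open_halfspace_lt)

text \<open>The triangle (0,0), (1,3), (3,2) serves as the start of a ray in the proof of
  unboundedness.\<close>

lemma triangle_region_nonempty: "vector [0, 0, 1, 3, 3, 2] \<in> triangle_region"
  by (simp add: mem_triangle_region)

lemma unbounded_triangle_region: "\<not> bounded triangle_region"
proof
  assume "bounded triangle_region"
  then obtain B where B: "\<And>x. x \<in> triangle_region \<Longrightarrow> norm x \<le> B"
    by (auto simp: bounded_iff)
  \<comment> \<open>Translation along \<open>1\<close> stays in the region, and it moves the first
    coordinate from 0 to \<open>B + 1\<close>.\<close>
  have "B + 1 \<le> \<bar>(vector [0, 0, 1, 3, 3, 2] + (B + 1) *\<^sub>R 1 :: real ^ 6) $ 1\<bar>"
    by simp
  also have "\<dots> \<le> norm (vector [0, 0, 1, 3, 3, 2] + (B + 1) *\<^sub>R 1 :: real ^ 6)"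
    by (rule component_le_norm_cart)
  also have "\<dots> \<le> B"
    by (rule B) (simp add: triangle_region_nonempty)
  finally show False
    by simp
qed

lemma interior_point_in_trop_proj: "interior_point x \<in> trop_proj"
  by (simp add: interior_point_def trop_proj_def trop_coords_def)

text \<open>The projective view is the last two conjuncts: the region maps into
  \<open>trop_proj\<close> and is a union of full fibres of \<open>interior_point\<close>, so its
  image determines it.\<close>

theorem theorem1:
  fixes a b c :: "real ^ 2"
  shows
    "(transversal_triangle (affine_point a) (affine_point b) (affine_point c) \<longleftrightarrow>
       (\<exists>p q r. mset [p, q, r] = mset [a, b, c] \<and> triangle_ineqs p q r)) \<and>
     open_polyhedron triangle_region \<and> open triangle_region \<and> \<not> bounded triangle_region \<and>
     (\<forall>l::real. (\<lambda>x. x + l *\<^sub>R 1) ` triangle_region = triangle_region) \<and>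
     interior_point ` triangle_region \<subseteq> trop_proj \<and>
     interior_point -` (interior_point ` triangle_region) = triangle_region"
proof (intro conjI allI)
  show "(\<lambda>x. x + l *\<^sub>R 1) ` triangle_region = triangle_region" for l
  proof (intro set_eqI iffI)
    fix x assume "x \<in> triangle_region"
    then show "x \<in> (\<lambda>x. x + l *\<^sub>R 1) ` triangle_region"
      by (intro image_eqI[of _ _ "x + (- l) *\<^sub>R 1"])
        (simp, simp only: add_scaleR_one_mem_triangle_region)
  qed auto
  show "interior_point -` (interior_point ` triangle_region) = triangle_region"
    by (auto simp: interior_point_eq_iff)
qed (use transversal_triangle_affine_iff open_polyhedron_triangle_region open_open_polyhedron
    unbounded_triangle_region interior_point_in_trop_proj in auto)

end
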